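(* Let $n>1$ be an integer and let $a,b\in\mathbb Z_n$ be incomparable with respect to $\leq$. Let $d=\gcd(\gcd(a-1,b-1),n)$. Then the meet $a\wedge b$ (greatest lower bound of $\{a,b\}$) exists in $(\mathbb Z_n,\leq)$ if and only if the ideal $(n/d)$ of $\mathbb Z_n$ has a largest element with respect to $\leq$.
   Context: On $\mathbb Z_n$ define the partial order $\leq$ by: $a\leq b$ iff $a=b$ or $a\equiv ab\pmod n$. For $x\in\mathbb Z_n$, $(x)$ denotes the ideal of $\mathbb Z_n$ generated by $x$. Gcds are taken of integer representatives. *)

theory Defs
  imports "HOL-Number_Theory.Residues" "HOL-Algebra.Ideal" "HOL-Algebra.Order"
begin

definition zn_order :: "int \<Rightarrow> int gorder" where
  "zn_order n =
     \<lparr>carrier = carrier (residue_ring n),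
      eq = (=),
      le = (\<lambda>a b. a = b \<or> [a = a * b] (mod n))\<rparr>"

lemma partial_order_zn_order:
  "partial_order (zn_order n)"
proof
  fix x y
  assume xy: "x \<sqsubseteq>\<^bsub>zn_order n\<^esub> y" "y \<sqsubseteq>\<^bsub>zn_order n\<^esub> x"
    and c: "x \<in> carrier (zn_order n)" "y \<in> carrier (zn_order n)"
  have "[x = y] (mod n)"
    using xy by (auto simp: zn_order_def) (metis cong_sym cong_trans mult.commute)
  then show "x .=\<^bsub>zn_order n\<^esub> y"
    using c by (auto simp: zn_order_def residue_ring_def cong_def)
next
  fix x y z
  assume xy: "x \<sqsubseteq>\<^bsub>zn_order n\<^esub> y" and yz: "y \<sqsubseteq>\<^bsub>zn_order n\<^esub> z"
  show "x \<sqsubseteq>\<^bsub>zn_order n\<^esub> z"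
  proof (cases "x = y \<or> y = z")
    case True
    then show ?thesis using xy yz by auto
  next
    case False
    then have 1: "[x = x * y] (mod n)" and 2: "[y = y * z] (mod n)"
      using xy yz by (auto simp: zn_order_def)
    have "[x * y = x * (y * z)] (mod n)"
      using 2 by (rule cong_scalar_left)
    moreover have "[x * z = x * y * z] (mod n)"
      using 1 by (rule cong_scalar_right)
    ultimately have "[x = x * z] (mod n)"
      using 1 by (metis cong_sym cong_trans mult.assoc)
    then show ?thesis by (simp add: zn_order_def)
  qed
qed (auto simp: zn_order_def)

end

theory Submission
  imports Defs
begin

text \<open>
  If \<open>A\<close> has no least element, then no lower bound of \<open>A\<close> lies in \<open>A\<close>, so the disjunct \<open>c = x\<close> of
  the order never holds and the lower bounds of \<open>A\<close> are the \<open>c\<close> with \<open>c (x - 1) \<equiv> 0\<close> for all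
  \<open>x \<in> A\<close>. They form the annihilator of the gcd \<open>d\<close> of the differences \<open>x - 1\<close>, which is the ideal
  \<open>(n div gcd d n)\<close>. A meet of \<open>A\<close> is a largest element of this ideal; two incomparable elements
  form such a set \<open>A\<close>.
\<close>

lemma dvd_mult_Gcd_iff:
  fixes n c :: "'a :: semiring_Gcd"
  shows "n dvd c * Gcd A \<longleftrightarrow> (\<forall>x\<in>A. n dvd c * x)"
proof -
  have "n dvd c * Gcd A \<longleftrightarrow> n dvd Gcd ((*) c ` A)"
    by (simp add: Gcd_mult)
  also have "\<dots> \<longleftrightarrow> (\<forall>x\<in>A. n dvd c * x)"
    by (simp add: dvd_Gcd_iff)
  finally show ?thesis .
qed

lemma div_gcd_dvd_iff:
  fixes n c d :: "'a :: semiring_gcd"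
  assumes "n \<noteq> 0"
  shows "n div gcd d n dvd c \<longleftrightarrow> n dvd c * d"
proof -
  have "n div gcd d n dvd c \<longleftrightarrow> n dvd c * gcd d n"
    using assms by (simp add: div_dvd_iff_mult)
  also have "\<dots> \<longleftrightarrow> n dvd gcd (c * d) (c * n)"
    by (simp add: gcd_mult_left)
  also have "\<dots> \<longleftrightarrow> n dvd c * d"
    by simp
  finally show ?thesis .
qed

lemma (in residues) genideal_singleton_eq_multiples_gcd:
  "Idl {e mod m} = {c \<in> carrier R. gcd e m dvd c}"
proof -
  have "Idl {e mod m} = PIdl (e mod m)"
    by (simp add: cgenideal_eq_genideal)
  also have "\<dots> = {c \<in> carrier R. gcd e m dvd c}"
  proof (intro equalityI subsetI)
    fix c
    assume "c \<in> PIdl (e mod m)"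
    then obtain y where "c = y * e mod m"
      by (auto simp: cgenideal_def res_mult_eq mod_mult_right_eq)
    then show "c \<in> {c \<in> carrier R. gcd e m dvd c}"
      by (simp add: dvd_mod)
  next
    fix c
    assume c: "c \<in> {c \<in> carrier R. gcd e m dvd c}"
    then obtain y where "[e * y = c] (mod m)"
      using cong_solve_dvd_int by blast
    then have "c = (y mod m) \<otimes> (e mod m)"
      using c by (simp add: res_carrier_eq res_mult_eq cong_def mod_mult_eq mult.commute)
    then show "c \<in> PIdl (e mod m)"
      by (auto simp: cgenideal_def)
  qed
  finally show ?thesis .
qed

lemma (in residues) annihilator_eq_genideal:
  "{c \<in> carrier R. m dvd c * d} = Idl {(m div gcd d m) mod m}"
proof -
  have "gcd (m div gcd d m) m = m div gcd d m"
    using m_gt_one by (simp add: gcd_proj1_iff div_dvd_iff_mult pos_imp_zdiv_nonneg_iff)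
  then show ?thesis
    using m_gt_one by (simp add: genideal_singleton_eq_multiples_gcd div_gcd_dvd_iff)
qed

lemma zn_order_le_iff:
  "c \<sqsubseteq>\<^bsub>zn_order n\<^esub> x \<longleftrightarrow> c = x \<or> n dvd c * (x - 1)"
  by (simp add: zn_order_def cong_iff_dvd_diff dvd_diff_commute[of n c] right_diff_distrib)

lemma Lower_zn_order_eq_annihilator:
  assumes "A \<subseteq> carrier (zn_order n)" and "\<nexists>l. least (zn_order n) l A"
  shows "Lower (zn_order n) A = {c \<in> carrier (zn_order n). n dvd c * (GCD x\<in>A. x - 1)}"
proof -
  have "(\<forall>x\<in>A. c \<sqsubseteq>\<^bsub>zn_order n\<^esub> x) \<longleftrightarrow> (\<forall>x\<in>A. n dvd c * (x - 1))" for c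
  proof
    assume lower: "\<forall>x\<in>A. c \<sqsubseteq>\<^bsub>zn_order n\<^esub> x"
    then have "c \<notin> A"
      using assms by (auto simp: least_def)
    with lower show "\<forall>x\<in>A. n dvd c * (x - 1)"
      by (auto simp: zn_order_le_iff)
  qed (simp add: zn_order_le_iff)
  then show ?thesis
    using assms(1) by (auto simp: Lower_def dvd_mult_Gcd_iff)
qed

lemma Lower_zn_order_eq_genideal:
  assumes "n > 1" and "A \<subseteq> carrier (zn_order n)" and "\<nexists>l. least (zn_order n) l A"
  shows "Lower (zn_order n) A =
    Idl\<^bsub>residue_ring n\<^esub> {(n div gcd (GCD x\<in>A. x - 1) n) mod n}"
proof -
  have "Lower (zn_order n) A = {c \<in> carrier (residue_ring n). n dvd c * (GCD x\<in>A. x - 1)}"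
    using Lower_zn_order_eq_annihilator[OF assms(2,3)] by (simp add: zn_order_def)
  also have "\<dots> = Idl\<^bsub>residue_ring n\<^esub> {(n div gcd (GCD x\<in>A. x - 1) n) mod n}"
    using assms(1) by (intro residues.annihilator_eq_genideal residues.intro)
  finally show ?thesis .
qed

theorem theorem3p3:
  fixes n a b d :: int
  assumes "n > 1"
    and "a \<in> carrier (residue_ring n)"
    and "b \<in> carrier (residue_ring n)"
    and "\<not> a \<sqsubseteq>\<^bsub>zn_order n\<^esub> b"
    and "\<not> b \<sqsubseteq>\<^bsub>zn_order n\<^esub> a"
    and "d = gcd (gcd (a - 1) (b - 1)) n"
  shows "(\<exists>m. is_glb (zn_order n) m {a, b}) \<longleftrightarrow>
         (\<exists>g. greatest (zn_order n) g (Idl\<^bsub>residue_ring n\<^esub> {(n div d) mod n}))"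
proof -
  have "{a, b} \<subseteq> carrier (zn_order n)"
    using assms(2,3) by (simp add: zn_order_def)
  moreover have "\<nexists>l. least (zn_order n) l {a, b}"
    using assms(4,5) by (auto simp: least_def)
  ultimately have "Lower (zn_order n) {a, b} = Idl\<^bsub>residue_ring n\<^esub> {(n div d) mod n}"
    using assms(1,6) by (simp add: Lower_zn_order_eq_genideal)
  then show ?thesis
    by simp
qed

end
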